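(* Let $M$ (men) and $W$ (women) be disjoint finite sets with $|M|\ge3$ and $|W|\ge3$. Then no stable two-sides-querying matching rule $C:\mathcal P(W)^M\times\mathcal P(M)^W\to\mathcal M$ is OSP-implementable for $M$. Moreover, no stable two-sides-querying matching mechanism is OSP for more than two men.
   Context: A preference list (for a man) over $W$ is a totally ordered subset of $W$; women not on the list are unacceptable. $\mathcal P(W)$ is the set of all preference lists over $W$; $\mathcal P(M)$ is defined analogously for women's lists over $M$. Given a man's list $p_m$, write $w\succ_m w'$ if $w$ is ranked higher than $w'$ on $p_m$, or $w$ is on $p_m$ and $w'$ is not; being unmatched counts as an outcome not on the list, so every listed woman is strictly preferred to being unmatched. Write $w\succeq_m w'$ if not $w'\succ_m w$. Similarly for women. A matching is a one-to-one mapping between a subset of $M$ and a subset of $W$; $\mathcal M$ is the set of matchings; $\mu_a$ is the match of participant $a$ in $\mu$, with $\mu_a=a$ if $a$ is unmatched. For profiles $\bar p\in\mathcal P(W)^M$, $\bar q\in\mathcal P(M)^W$, a matching $\mu$ is unstable with respect to $\bar p,\bar q$ if there are a man $m$ and a woman $w$ each preferring the other over what $\mu$ gives them, or some participant is matched with someone not on his or her preference list; otherwise $\mu$ is stable. Let $\mathcal P=\mathcal P(W)^M\times\mathcal P(M)^W$; for $\bar r=(\bar p,\bar q)\in\mathcal P$ write $r_m=p_m$ for $m\in M$ and $r_w=q_w$ for $w\in W$. A two-sides-querying matching rule is a function $C:\mathcal P\to\mathcal M$; $C_a(\bar r)$ is the match of $a$. It is stable if for all $(\bar p,\bar q)\in\mathcal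 P$, $C(\bar p,\bar q)$ is stable with respect to $\bar p,\bar q$. For a participant $a$ let $\mathcal P_a=\mathcal P(W)$ if $a\in M$ and $\mathcal P_a=\mathcal P(M)$ if $a\in W$. A two-sides-querying (extensive-form) matching mechanism $\mathcal I$ consists of: (1) a finite rooted tree $T$ with edges directed away from the root; (2) a map $X$ from leaves of $T$ to $\mathcal M$; (3) a map $Q$ from internal nodes of $T$ to $M\cup W$; (4) a map $A$ assigning to each edge outgoing from a node $n$ a nonempty subset of $\mathcal P_{Q(n)}$ such that the sets on distinct edges outgoing from the same node are disjoint, and the union of the sets on the edges outgoing from $n$ equals the set $A(e)$ for the last edge $e$, along the path from the root to $n$, that is outgoing from a node $n'$ with $Q(n')=Q(n)$, or equals $\mathcal P_{Q(n)}$ if there is no such edge. A profile $\bar r\in\mathcal P$ passes through a node $n$ if for every edge $e$ on the path from the root to $n$, with source node $n'$, $r_{Q(n')}\in A(e)$. The rule $C^{\mathcal I}$ implemented by $\mathcal I$ maps $\bar r$ to $X(n)$, where $n$ is the unique leaf through which $\bar r$ passes. $\mathcal I$ is stable if $C^{\mathcal I}$ is stable. Two lists $r,r'$ diverge at $n$ if there are distinct edges $e,e'$ outgoing from $n$ with $r\in A(e)$, $r'\in A(e')$. $\mathcal I$ is obviously strategy-proof (OSP) for a participant $a\in M\cup W$ if for every node $n$ with $Q(n)=a$ and all $\bar r,\bar r'\in\mathcal P$ that both pass through $n$ such that $r_a$ and $r'_a$ diverge at $n$, $C^{\mathcal I}_a(\bar r)\succeq_a C^{\mathcal I}_a(\bar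 r')$ according to $r_a$. A two-sides-querying matching rule $C$ is OSP-implementable for a set $A\subseteq M\cup W$ of participants if $C=C^{\mathcal I}$ for some two-sides-querying matching mechanism $\mathcal I$ that is OSP for every participant in $A$. *)

theory Defs
  imports Main "HOL-Library.FuncSet"
begin

(* Men and women are two disjoint sets M, W of elements of one type, so that "the match of an
   unmatched participant is the participant itself" can be said literally. *)

section \<open>Preferences and stable matchings\<close>

(* A totally ordered subset of X is given by its duplicate-free enumeration, best element first. *)
definition pref_lists :: "'a set \<Rightarrow> 'a list set" where
  "pref_lists X = {l. distinct l \<and> set l \<subseteq> X}"

definition ranked_higher :: "'a list \<Rightarrow> 'a \<Rightarrow> 'a \<Rightarrow> bool" where
  "ranked_higher l x y \<longleftrightarrow> (\<exists>i j. i < j \<and> j < length l \<and> l ! i = x \<and> l ! j = y)"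

definition prefers :: "'a list \<Rightarrow> 'a \<Rightarrow> 'a \<Rightarrow> bool" where
  "prefers l x y \<longleftrightarrow> ranked_higher l x y \<or> (x \<in> set l \<and> y \<notin> set l)"

definition weakly_prefers :: "'a list \<Rightarrow> 'a \<Rightarrow> 'a \<Rightarrow> bool" where
  "weakly_prefers l x y \<longleftrightarrow> \<not> prefers l y x"

(* A matching is a partial injection from M to W. *)
type_synonym 'a matching = "'a \<rightharpoonup> 'a"

definition matchings :: "'a set \<Rightarrow> 'a set \<Rightarrow> 'a matching set" where
  "matchings M W = {\<mu>. dom \<mu> \<subseteq> M \<and> ran \<mu> \<subseteq> W \<and> inj_on \<mu> (dom \<mu>)}"

definition match_of :: "'a matching \<Rightarrow> 'a \<Rightarrow> 'a" where
  "match_of \<mu> a =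
    (if a \<in> dom \<mu> then the (\<mu> a)
     else if a \<in> ran \<mu> then (THE m. \<mu> m = Some a)
     else a)"

type_synonym 'a profile = "('a \<Rightarrow> 'a list) \<times> ('a \<Rightarrow> 'a list)"

definition profiles :: "'a set \<Rightarrow> 'a set \<Rightarrow> 'a profile set" where
  "profiles M W = (M \<rightarrow>\<^sub>E pref_lists W) \<times> (W \<rightarrow>\<^sub>E pref_lists M)"

(* The list r_a of participant a in the profile r = (p, q). *)
definition pref_of :: "'a set \<Rightarrow> 'a profile \<Rightarrow> 'a \<Rightarrow> 'a list" where
  "pref_of M r a = (if a \<in> M then fst r a else snd r a)"

definition prefs_for :: "'a set \<Rightarrow> 'a set \<Rightarrow> 'a \<Rightarrow> 'a list set" where
  "prefs_for M W a = (if a \<in> M then pref_lists W else pref_lists M)"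

definition unstable :: "'a set \<Rightarrow> 'a set \<Rightarrow> 'a profile \<Rightarrow> 'a matching \<Rightarrow> bool" where
  "unstable M W r \<mu> \<longleftrightarrow>
    (\<exists>m\<in>M. \<exists>w\<in>W. prefers (pref_of M r m) w (match_of \<mu> m) \<and>
                 prefers (pref_of M r w) m (match_of \<mu> w)) \<or>
    (\<exists>a\<in>M \<union> W. match_of \<mu> a \<noteq> a \<and> match_of \<mu> a \<notin> set (pref_of M r a))"

definition stable :: "'a set \<Rightarrow> 'a set \<Rightarrow> 'a profile \<Rightarrow> 'a matching \<Rightarrow> bool" where
  "stable M W r \<mu> \<longleftrightarrow> \<not> unstable M W r \<mu>"

section \<open>Matching rules and extensive-form mechanisms\<close>

(* Only the values of a rule on profiles M W are relevant. *)
type_synonym 'a rule = "'a profile \<Rightarrow> 'a matching"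

definition matching_rule :: "'a set \<Rightarrow> 'a set \<Rightarrow> 'a rule \<Rightarrow> bool" where
  "matching_rule M W C \<longleftrightarrow> C \<in> profiles M W \<rightarrow> matchings M W"

definition stable_rule :: "'a set \<Rightarrow> 'a set \<Rightarrow> 'a rule \<Rightarrow> bool" where
  "stable_rule M W C \<longleftrightarrow> (\<forall>r\<in>profiles M W. stable M W r (C r))"

(* A finite rooted tree with its labels: a leaf n carries X(n); an internal node n carries the
   queried participant Q(n) and the finite family of its outgoing edges e, each given as A(e)
   together with the subtree below e. *)
datatype 'a game_tree =
  Leaf "'a matching"
| Query 'a "('a list set \<times> 'a game_tree) list"

(* node T path t: t is the subtree of T at a node, and path lists the edges e from the root to that
   node, in order, each as (Q(source of e), A(e)).  In a mechanism (see below) the path determines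
   the node, as the sets on the edges leaving a node are nonempty and disjoint. *)
inductive node ::
  "'a game_tree \<Rightarrow> ('a \<times> 'a list set) list \<Rightarrow> 'a game_tree \<Rightarrow> bool" for T where
  root: "node T [] T"
| edge: "node T path (Query a es) \<Longrightarrow> (S, t) \<in> set es \<Longrightarrow> node T (path @ [(a, S)]) t"

(* The label of the last edge on the path at which a was queried, or all of P_a if there is none. *)
definition remaining ::
  "'a set \<Rightarrow> 'a set \<Rightarrow> ('a \<times> 'a list set) list \<Rightarrow> 'a \<Rightarrow> 'a list set" where
  "remaining M W path a =
    (if a \<in> fst ` set path then snd (last (filter (\<lambda>e. fst e = a) path))
     else prefs_for M W a)"

definition mechanism :: "'a set \<Rightarrow> 'a set \<Rightarrow> 'a game_tree \<Rightarrow> bool" where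
  "mechanism M W T \<longleftrightarrow>
    (\<forall>path \<mu>. node T path (Leaf \<mu>) \<longrightarrow> \<mu> \<in> matchings M W) \<and>
    (\<forall>path a es. node T path (Query a es) \<longrightarrow>
       a \<in> M \<union> W \<and>
       es \<noteq> [] \<and>
       (\<forall>e\<in>set es. fst e \<noteq> {} \<and> fst e \<subseteq> prefs_for M W a) \<and>
       (\<forall>i<length es. \<forall>j<length es. i \<noteq> j \<longrightarrow> fst (es ! i) \<inter> fst (es ! j) = {}) \<and>
       (\<Union>e\<in>set es. fst e) = remaining M W path a)"

definition passes :: "'a set \<Rightarrow> 'a profile \<Rightarrow> ('a \<times> 'a list set) list \<Rightarrow> bool" where
  "passes M r path \<longleftrightarrow> (\<forall>(a, S)\<in>set path. pref_of M r a \<in> S)"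

(* In a mechanism, each profile passes through exactly one leaf. *)
definition implemented_rule :: "'a set \<Rightarrow> 'a game_tree \<Rightarrow> 'a rule" where
  "implemented_rule M T r = (THE \<mu>. \<exists>path. node T path (Leaf \<mu>) \<and> passes M r path)"

definition stable_mechanism :: "'a set \<Rightarrow> 'a set \<Rightarrow> 'a game_tree \<Rightarrow> bool" where
  "stable_mechanism M W T \<longleftrightarrow> mechanism M W T \<and> stable_rule M W (implemented_rule M T)"

section \<open>Obvious strategy-proofness\<close>

definition diverge ::
  "('a list set \<times> 'a game_tree) list \<Rightarrow> 'a list \<Rightarrow> 'a list \<Rightarrow> bool" where
  "diverge es l l' \<longleftrightarrow>
    (\<exists>i<length es. \<exists>j<length es. i \<noteq> j \<and> l \<in> fst (es ! i) \<and> l' \<in> fst (es ! j))"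

definition osp_for :: "'a set \<Rightarrow> 'a set \<Rightarrow> 'a game_tree \<Rightarrow> 'a \<Rightarrow> bool" where
  "osp_for M W T a \<longleftrightarrow>
    (\<forall>path es. node T path (Query a es) \<longrightarrow>
      (\<forall>r\<in>profiles M W. \<forall>r'\<in>profiles M W.
         passes M r path \<and> passes M r' path \<and> diverge es (pref_of M r a) (pref_of M r' a) \<longrightarrow>
         weakly_prefers (pref_of M r a)
           (match_of (implemented_rule M T r) a) (match_of (implemented_rule M T r') a)))"

definition osp_implementable :: "'a set \<Rightarrow> 'a set \<Rightarrow> 'a rule \<Rightarrow> 'a set \<Rightarrow> bool" where
  "osp_implementable M W C A \<longleftrightarrow>
    (\<exists>T. mechanism M W T \<and> (\<forall>r\<in>profiles M W. C r = implemented_rule M T r) \<and>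
         (\<forall>a\<in>A. osp_for M W T a))"

end

theory Submission imports Defs begin

text \<open>
  Give three women \<open>w\<^sub>k\<close> (indices modulo 3) the lists \<open>m\<^sub>k, m\<^sub>k\<^sub>+\<^sub>1, m\<^sub>k\<^sub>+\<^sub>2\<close>, let three men \<open>m\<^sub>k\<close> have either the
  list \<open>a\<^sub>k = w\<^sub>k\<^sub>+\<^sub>1, w\<^sub>k\<close> or the list \<open>b\<^sub>k = w\<^sub>k\<^sub>+\<^sub>2, w\<^sub>k\<^sub>+\<^sub>1\<close>, and let all other lists be empty.
  Under \<open>(a\<^sub>0, b\<^sub>1, b\<^sub>2)\<close> no stable matching gives \<open>m\<^sub>0\<close> his first choice \<open>w\<^sub>1\<close>, while under
  \<open>(b\<^sub>0, b\<^sub>1, a\<^sub>2)\<close> every stable matching does. Hence \<open>a\<^sub>0\<close> and \<open>b\<^sub>0\<close> cannot diverge at a node which all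
  eight profiles pass through, and by rotation the same holds for the other two men. So the eight
  profiles reach the same leaf, although they have no common stable matching.
\<close>

section \<open>Stable matchings\<close>

text \<open>\<open>match_of\<close> tests both sides of the market. Disjointness of \<open>M\<close>
  and \<open>W\<close> leaves a single relevant branch for each participant, and injectivity makes
  the definite description in the woman's branch unique.\<close>

lemma match_of_iff:
  assumes "\<mu> \<in> matchings M W" "M \<inter> W = {}" "m \<in> M" "w \<in> W"
  shows "match_of \<mu> m = w \<longleftrightarrow> \<mu> m = Some w" and "match_of \<mu> w = m \<longleftrightarrow> \<mu> m = Some w"
proof -
  have dr: "dom \<mu> \<subseteq> M" "ran \<mu> \<subseteq> W" "inj_on \<mu> (dom \<mu>)"
    using assms(1) by (auto simp: matchings_def)
  have "m \<notin> ran \<mu>" "w \<notin> dom \<mu>" "m \<noteq> w"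
    using dr assms by auto
  then show "match_of \<mu> m = w \<longleftrightarrow> \<mu> m = Some w"
    by (auto simp: match_of_def dom_def)
  have the: "(THE x. \<mu> x = Some w) = x" if "\<mu> x = Some w" for x
    using that dr(3) by (intro the_equality) (auto simp: inj_on_def dom_def)
  show "match_of \<mu> w = m \<longleftrightarrow> \<mu> m = Some w"
    using \<open>w \<notin> dom \<mu>\<close> \<open>m \<noteq> w\<close> the by (auto simp: match_of_def ran_def)
qed

lemma match_of_sym:
  assumes "\<mu> \<in> matchings M W" "M \<inter> W = {}" "m \<in> M" "w \<in> W"
  shows "match_of \<mu> m = w \<longleftrightarrow> match_of \<mu> w = m"
  using match_of_iff[OF assms] by simp

lemma prefers_hd: "y \<noteq> x \<Longrightarrow> prefers (x # l) x y"
proof (cases "y \<in> set l")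
  case True
  then obtain k where "k < length l" "l ! k = y"
    by (auto simp: in_set_conv_nth)
  then show ?thesis
    unfolding prefers_def ranked_higher_def
    by (intro disjI1 exI[of _ 0] exI[of _ "Suc k"]) simp
qed (simp add: prefers_def)

lemma prefers_unlisted: "x \<in> set l \<Longrightarrow> y \<notin> set l \<Longrightarrow> prefers l x y"
  by (simp add: prefers_def)

lemma prefers_second: "prefers (x # y # z # l) y z"
  unfolding prefers_def ranked_higher_def
  by (intro disjI1 exI[of _ "Suc 0"] exI[of _ "Suc (Suc 0)"]) simp

lemma stable_no_block:
  assumes "stable M W r \<mu>" "m \<in> M" "w \<in> W" "prefers (pref_of M r m) w (match_of \<mu> m)"
  shows "\<not> prefers (pref_of M r w) m (match_of \<mu> w)"
  using assms by (auto simp: stable_def unstable_def)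

lemma stable_listed:
  assumes "stable M W r \<mu>" "a \<in> M \<union> W" "match_of \<mu> a \<noteq> a"
  shows "match_of \<mu> a \<in> set (pref_of M r a)"
  using assms by (auto simp: stable_def unstable_def)

text \<open>Otherwise \<open>m2\<close>, who also ranks \<open>w1\<close> first, would be matched
  elsewhere while \<open>w1\<close> ranks him above \<open>m0\<close>, so \<open>m2\<close> and
  \<open>w1\<close> would block.\<close>

lemma not_first_choice:
  assumes st: "stable M W r \<mu>" and mu: "\<mu> \<in> matchings M W" and disj: "M \<inter> W = {}"
    and "m0 \<in> M" "m2 \<in> M" "w1 \<in> W" "m0 \<noteq> m2"
    and r: "pref_of M r m2 = [w1, w0]" "pref_of M r w1 = [m1, m2, m0]"
  shows "match_of \<mu> m0 \<noteq> w1"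
proof
  assume "match_of \<mu> m0 = w1"
  then have w1: "match_of \<mu> w1 = m0"
    using match_of_sym[OF mu disj] assms by blast
  then have "match_of \<mu> m2 \<noteq> w1"
    using match_of_sym[OF mu disj] assms by blast
  then have "\<not> prefers [m1, m2, m0] m2 m0"
    using stable_no_block[OF st, of m2 w1] prefers_hd[of "match_of \<mu> m2" w1] r w1 assms by simp
  then show False
    using prefers_second by metis
qed

text \<open>The matching is forced step by step. Both \<open>m1\<close> and \<open>m2\<close> want
  \<open>w0\<close>; she ranks only \<open>m0\<close> above \<open>m1\<close>, and \<open>m0\<close>
  does not list her, so she gets \<open>m1\<close>. Then \<open>m2\<close> falls back on
  \<open>w2\<close>, who ranks him first. With \<open>m1\<close> and \<open>m2\<close> gone,
  \<open>w1\<close> can do no better than \<open>m0\<close>, and \<open>m0\<close>, who has lost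
  \<open>w2\<close>, wants her.\<close>

lemma first_choice:
  assumes st: "stable M W r \<mu>" and mu: "\<mu> \<in> matchings M W" and disj: "M \<inter> W = {}"
    and mM: "m0 \<in> M" "m1 \<in> M" "m2 \<in> M" and mne: "m0 \<noteq> m1" "m1 \<noteq> m2" "m0 \<noteq> m2"
    and wW: "w0 \<in> W" "w1 \<in> W" "w2 \<in> W" and wne: "w0 \<noteq> w1" "w1 \<noteq> w2" "w0 \<noteq> w2"
    and r: "pref_of M r m0 = [w2, w1]" "pref_of M r m1 = [w0, w2]" "pref_of M r m2 = [w0, w2]"
      "pref_of M r w0 = [m0, m1, m2]" "pref_of M r w1 = [m1, m2, m0]"
      "pref_of M r w2 = [m2, m0, m1]"
  shows "match_of \<mu> m0 = w1"
proof -
  note sym = match_of_sym[OF mu disj]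
  have ne: "m \<noteq> w" if "m \<in> M" "w \<in> W" for m w
    using that disj by auto
  have m1: "match_of \<mu> m1 = w0"
  proof (rule ccontr)
    assume *: "match_of \<mu> m1 \<noteq> w0"
    then have np: "\<not> prefers [m0, m1, m2] m1 (match_of \<mu> w0)"
      using stable_no_block[OF st, of m1 w0] prefers_hd r mM wW by fastforce
    \<comment> \<open>An unmatched \<open>w0\<close> is covered too: her match is then
      \<open>w0\<close> itself, which counts as unlisted and hence as worse than
      \<open>m1\<close>.\<close>
    have "match_of \<mu> w0 \<in> {m0, m1, m2}"
      using np prefers_unlisted[of m1 "[m0, m1, m2]" "match_of \<mu> w0"] by auto
    moreover have "match_of \<mu> w0 \<noteq> m1"
      using * sym mM wW by blast
    moreover have "match_of \<mu> w0 \<noteq> m2"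
      using np prefers_second by metis
    ultimately have "match_of \<mu> m0 = w0"
      using sym mM wW by blast
    then show False
      using stable_listed[OF st, of m0] r mM wne ne[OF mM(1) wW(1)] by auto
  qed
  have m2: "match_of \<mu> m2 = w2"
  proof (rule ccontr)
    assume *: "match_of \<mu> m2 \<noteq> w2"
    have "match_of \<mu> m2 \<noteq> w0"
      using m1 sym mM wW mne by metis
    with * have "prefers [w0, w2] w2 (match_of \<mu> m2)"
      by (intro prefers_unlisted) auto
    then have "\<not> prefers [m2, m0, m1] m2 (match_of \<mu> w2)"
      using stable_no_block[OF st, of m2 w2] r mM wW by simp
    then have "match_of \<mu> w2 = m2"
      using prefers_hd by metis
    then show False
      using * sym mM wW by blast
  qed
  show ?thesis
  proof (rule ccontr)
    assume *: "match_of \<mu> m0 \<noteq> w1"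
    have "match_of \<mu> m0 \<noteq> w2"
      using m2 sym mM wW mne by metis
    with * have "prefers [w2, w1] w1 (match_of \<mu> m0)"
      by (intro prefers_unlisted) auto
    then have "\<not> prefers [m1, m2, m0] m0 (match_of \<mu> w1)"
      using stable_no_block[OF st, of m0 w1] r mM wW by simp
    then have "match_of \<mu> w1 \<in> {m1, m2, m0}"
      using prefers_unlisted[of m0 "[m1, m2, m0]" "match_of \<mu> w1"] by auto
    then show False
      using * m1 m2 sym mM wW wne by (metis empty_iff insert_iff)
  qed
qed

section \<open>Leaves of a mechanism\<close>

lemma passes_snoc: "passes M r (path @ [(a, S)]) \<longleftrightarrow> passes M r path \<and> pref_of M r a \<in> S"
  by (auto simp: passes_def)

lemma passes_remaining:
  assumes "passes M r path" "r \<in> profiles M W" "a \<in> M \<union> W"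
  shows "pref_of M r a \<in> remaining M W path a"
proof (cases "a \<in> fst ` set path")
  case True
  let ?f = "filter (\<lambda>e. fst e = a) path"
  have "?f \<noteq> []"
    using True by (auto simp: filter_empty_conv)
  from last_in_set[OF this] have "last ?f \<in> set path" "fst (last ?f) = a"
    by simp_all
  then obtain S where "last ?f = (a, S)" "(a, S) \<in> set path"
    by (metis prod.collapse)
  then show ?thesis
    using True assms(1) by (auto simp: passes_def remaining_def)
next
  case False
  then show ?thesis
    using assms(2,3) by (auto simp: remaining_def prefs_for_def pref_of_def profiles_def)
qed

lemma mechanism_query:
  assumes "mechanism M W T" "node T path (Query a es)"
  shows "a \<in> M \<union> W" and "(\<Union>e\<in>set es. fst e) = remaining M W path a"
    and "i < length es \<Longrightarrow> j < length es \<Longrightarrow> i \<noteq> j \<Longrightarrow> fst (es ! i) \<inter> fst (es ! j) = {}"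
  using assms by (simp_all add: mechanism_def)

lemma mechanism_leaf:
  assumes "mechanism M W T" "node T path (Leaf \<mu>)"
  shows "\<mu> \<in> matchings M W"
  using assms by (auto simp: mechanism_def)

lemma query_edge:
  assumes "mechanism M W T" "node T path (Query a es)" "passes M r path" "r \<in> profiles M W"
  obtains S t where "(S, t) \<in> set es" "pref_of M r a \<in> S"
proof -
  have "pref_of M r a \<in> (\<Union>e\<in>set es. fst e)"
    using mechanism_query(1,2)[OF assms(1,2)] passes_remaining[OF assms(3,4)] by simp
  then show thesis
    using that by auto
qed

lemma query_edge_unique:
  assumes "mechanism M W T" "node T path (Query a es)"
    and "(S, t) \<in> set es" "(S', t') \<in> set es" "l \<in> S" "l \<in> S'"
  shows "S = S' \<and> t = t'"
proof -
  obtain i j where ij: "i < length es" "es ! i = (S, t)" "j < length es" "es ! j = (S', t')"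
    using assms(3,4) by (auto simp: in_set_conv_nth)
  then have "i = j"
    using mechanism_query(3)[OF assms(1,2) ij(1,3)] assms(5,6) by auto
  then show ?thesis
    using ij by simp
qed

section \<open>Uniqueness and existence of the leaf that a profile reaches\<close>

lemma node_snocD:
  assumes "node T (path @ [(a, S)]) t"
  shows "\<exists>es. node T path (Query a es) \<and> (S, t) \<in> set es"
  using assms by cases auto

lemma node_appendD:
  assumes "node T (path @ q) t" "q \<noteq> []"
  shows "\<exists>a es. node T path (Query a es)"
  using assms
proof (induction q arbitrary: t rule: rev_induct)
  case (snoc e q)
  obtain a S where e: "e = (a, S)"
    by (cases e)
  have "node T ((path @ q) @ [(a, S)]) t"
    using snoc.prems(1) by (simp add: e)
  then obtain es where es: "node T (path @ q) (Query a es)"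
    using node_snocD by metis
  then show ?case
    using snoc.IH by (cases "q = []") auto
qed simp

text \<open>Disjointness of the edge labels leaves a profile one way down from each node, so its
  route is determined level by level.\<close>

lemma node_unique:
  assumes "mechanism M W T" "node T path t" "passes M r path"
    and "node T path' t'" "passes M r path'" "length path = length path'"
  shows "path = path' \<and> t = t'"
  using assms(2-)
proof (induction arbitrary: path' t' rule: node.induct)
  case root
  then have "node T [] t'"
    by simp
  then have "t' = T"
    by cases auto
  then show ?case
    using root by simp
next
  case (edge path a es S t)
  obtain path0 a' S' where path': "path' = path0 @ [(a', S')]"
    using edge.prems(4) by (cases path' rule: rev_cases) auto
  obtain es' where es': "node T path0 (Query a' es')" "(S', t') \<in> set es'"
    using node_snocD[OF edge.prems(2)[unfolded path']] by blast
  have p: "passes M r path" "pref_of M r a \<in> S" and p0: "passes M r path0" "pref_of M r a' \<in> S'"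
    using edge.prems(1,3) by (simp_all add: path' passes_snoc)
  have "length path = length path0"
    using edge.prems(4) by (simp add: path')
  from edge.IH[OF p(1) es'(1) p0(1) this]
  have eq: "path = path0" "a' = a" "es' = es"
    by simp_all
  then have "S = S' \<and> t = t'"
    using query_edge_unique[OF assms(1) edge.hyps] es'(2) p(2) p0(2) by simp
  then show ?case
    using eq by (simp add: path')
qed

text \<open>If \<open>path'\<close> were strictly longer, its prefix of the length of
  \<open>path\<close> would end at an internal node, yet by \<open>node_unique\<close> it ends at
  the leaf.\<close>

lemma leaf_unique_aux:
  assumes "mechanism M W T" "node T path (Leaf \<mu>)" "passes M r path"
    and "node T path' t'" "passes M r path'" "length path \<le> length path'"
  shows "t' = Leaf \<mu>"
proof (cases "length path = length path'")
  case True
  then show ?thesis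
    using node_unique[OF assms(1-5)] by simp
next
  case False
  define p q where "p = take (length path) path'" and "q = drop (length path) path'"
  have pq: "path' = p @ q" "length p = length path" "q \<noteq> []"
    using False assms(6) by (auto simp: p_def q_def)
  obtain a es where es: "node T p (Query a es)"
    using node_appendD[OF assms(4)[unfolded pq(1)] pq(3)] by blast
  moreover have "passes M r p"
    using assms(5) by (auto simp: passes_def pq)
  ultimately show ?thesis
    using node_unique[OF assms(1-3), of p "Query a es"] pq by simp
qed

lemma leaf_unique:
  assumes "mechanism M W T" "node T path (Leaf \<mu>)" "passes M r path"
    and "node T path' (Leaf \<mu>')" "passes M r path'"
  shows "\<mu>' = \<mu>"
  using leaf_unique_aux[OF assms] leaf_unique_aux[OF assms(1,4,5,2,3)]
  by (metis game_tree.inject(1) nat_le_linear)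

lemma implemented_rule_leaf:
  assumes "mechanism M W T" "node T path (Leaf \<mu>)" "passes M r path"
  shows "implemented_rule M T r = \<mu>"
  unfolding implemented_rule_def
  using leaf_unique[OF assms] assms(2,3) by (intro the_equality) blast+

text \<open>From any node that it passes through, a profile can descend further, because the edges
  cover all lists still possible for the queried participant. Induction on the subtree ends the
  descent.\<close>

lemma leaf_exists:
  assumes "mechanism M W T" "r \<in> profiles M W" "node T path t" "passes M r path"
  shows "\<exists>path \<mu>. node T path (Leaf \<mu>) \<and> passes M r path"
  using assms(3,4)
proof (induction t arbitrary: path rule: game_tree.induct)
  case (Leaf \<mu>)
  then show ?case
    by blast
next
  case (Query a es)
  obtain S t where St: "(S, t) \<in> set es" "pref_of M r a \<in> S"
    using query_edge[OF assms(1) Query.prems assms(2)] by blast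
  show ?case
    using node.edge[OF Query.prems(1) St(1)] St Query.prems(2)
    by (intro Query.IH[OF St(1), of t "path @ [(a, S)]"]) (auto simp: passes_snoc)
qed

lemma implemented_rule_matching:
  assumes "mechanism M W T" "r \<in> profiles M W"
  shows "implemented_rule M T r \<in> matchings M W"
proof -
  obtain path \<mu> where "node T path (Leaf \<mu>)" "passes M r path"
    using leaf_exists[OF assms node.root] unfolding passes_def by fastforce
  then show ?thesis
    using implemented_rule_leaf[OF assms(1)] mechanism_leaf[OF assms(1)] by simp
qed

section \<open>Three obviously strategy-proof men\<close>

text \<open>Under \<open>r\<close> the man \<open>m0\<close> misses his favourite \<open>w1\<close>,
  but by acting as if his list were \<open>[w2, w1]\<close> he gets her under \<open>r'\<close>.
  Obvious strategy-proofness forbids this once both profiles pass through the node where his two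
  lists part. The participants are arbitrary so that the lemma can be rotated.\<close>

lemma no_divergence:
  assumes T: "stable_mechanism M W T" and disj: "M \<inter> W = {}"
    and mM: "m0 \<in> M" "m1 \<in> M" "m2 \<in> M" and mne: "m0 \<noteq> m1" "m1 \<noteq> m2" "m0 \<noteq> m2"
    and wW: "w0 \<in> W" "w1 \<in> W" "w2 \<in> W" and wne: "w0 \<noteq> w1" "w1 \<noteq> w2" "w0 \<noteq> w2"
    and osp: "osp_for M W T m0" and node: "node T path (Query m0 es)"
    and r: "r \<in> profiles M W" "passes M r path"
      "pref_of M r m0 = [w1, w0]" "pref_of M r m2 = [w1, w0]" "pref_of M r w1 = [m1, m2, m0]"
    and r': "r' \<in> profiles M W" "passes M r' path"
      "pref_of M r' m0 = [w2, w1]" "pref_of M r' m1 = [w0, w2]" "pref_of M r' m2 = [w0, w2]"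
      "pref_of M r' w0 = [m0, m1, m2]" "pref_of M r' w1 = [m1, m2, m0]"
      "pref_of M r' w2 = [m2, m0, m1]"
  shows "\<not> diverge es [w1, w0] [w2, w1]"
proof
  assume div: "diverge es [w1, w0] [w2, w1]"
  let ?C = "implemented_rule M T"
  have mech: "mechanism M W T" and st: "stable_rule M W ?C"
    using T by (auto simp: stable_mechanism_def)
  have "match_of (?C r) m0 \<noteq> w1"
    using not_first_choice[of M W r "?C r" m0 m2 w1 w0 m1] st r mM wW mne disj
      implemented_rule_matching[OF mech r(1)] by (auto simp: stable_rule_def)
  then have "prefers [w1, w0] w1 (match_of (?C r) m0)"
    by (rule prefers_hd)
  moreover have "match_of (?C r') m0 = w1"
    using st r' mM wW mne wne disj implemented_rule_matching[OF mech r'(1)]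
    by (intro first_choice[of M W r' _ m0 m1 m2 w0 w1 w2]) (auto simp: stable_rule_def)
  moreover have "weakly_prefers [w1, w0] (match_of (?C r) m0) (match_of (?C r') m0)"
    using osp[unfolded osp_for_def, rule_format, OF node, of r r'] r r' div by simp
  ultimately show False
    by (simp add: weakly_prefers_def)
qed

lemma diverge_sym: "diverge es l l' \<longleftrightarrow> diverge es l' l"
  unfolding diverge_def by blast

lemma three_osp_men_impossible:
  assumes T: "stable_mechanism M W T" and disj: "M \<inter> W = {}"
    and mM: "m0 \<in> M" "m1 \<in> M" "m2 \<in> M" and mne: "m0 \<noteq> m1" "m1 \<noteq> m2" "m0 \<noteq> m2"
    and wW: "w0 \<in> W" "w1 \<in> W" "w2 \<in> W" and wne: "w0 \<noteq> w1" "w1 \<noteq> w2" "w0 \<noteq> w2"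
    and osp: "osp_for M W T m0" "osp_for M W T m1" "osp_for M W T m2"
  shows False
proof -
  have mech: "mechanism M W T" and st: "stable_rule M W (implemented_rule M T)"
    using T by (auto simp: stable_mechanism_def)
  define q where "q = (\<lambda>w\<in>W. if w = w0 then [m0, m1, m2] else if w = w1 then [m1, m2, m0]
    else if w = w2 then [m2, m0, m1] else [])"
  define R where "R l0 l1 l2 = (\<lambda>m\<in>M. if m = m0 then l0 else if m = m1 then l1
    else if m = m2 then l2 else [], q)" for l0 l1 l2 :: "'a list"
  \<comment> \<open>The eight profiles. The second option of each man is the first option of the
    next man, so only three distinct lists occur.\<close>
  define F where "F = {R l0 l1 l2 | l0 l1 l2.
    l0 \<in> {[w1, w0], [w2, w1]} \<and> l1 \<in> {[w2, w1], [w0, w2]} \<and> l2 \<in> {[w0, w2], [w1, w0]}}"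
  have prof: "r \<in> profiles M W" if "r \<in> F" for r
  proof -
    have "q \<in> W \<rightarrow>\<^sub>E pref_lists M"
      using mM mne by (auto simp: q_def pref_lists_def split: if_splits)
    moreover have "{[w1, w0], [w2, w1], [w0, w2]} \<subseteq> pref_lists W"
      using wW wne by (simp add: pref_lists_def)
    moreover have "[] \<in> pref_lists W"
      by (simp add: pref_lists_def)
    ultimately have "R l0 l1 l2 \<in> profiles M W"
      if "l0 \<in> {[w1, w0], [w2, w1], [w0, w2]}" "l1 \<in> {[w1, w0], [w2, w1], [w0, w2]}"
        "l2 \<in> {[w1, w0], [w2, w1], [w0, w2]}" for l0 l1 l2
      using subsetD[OF _ that(1)] subsetD[OF _ that(2)] subsetD[OF _ that(3)]
      by (simp add: R_def profiles_def)
    then show ?thesis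
      using that by (force simp: F_def)
  qed
  have pm: "pref_of M (R l0 l1 l2) m0 = l0" "pref_of M (R l0 l1 l2) m1 = l1"
      "pref_of M (R l0 l1 l2) m2 = l2" for l0 l1 l2
    using mM mne by (auto simp: R_def pref_of_def)
  have "w0 \<notin> M" "w1 \<notin> M" "w2 \<notin> M"
    using wW disj by auto
  then have pw: "pref_of M (R l0 l1 l2) w0 = [m0, m1, m2]" "pref_of M (R l0 l1 l2) w1 = [m1, m2, m0]"
      "pref_of M (R l0 l1 l2) w2 = [m2, m0, m1]" for l0 l1 l2
    using wW wne by (auto simp: R_def q_def pref_of_def)
  \<comment> \<open>Only queries to the three men could separate members of
    \<open>F\<close>.\<close>
  have const: "pref_of M r a = pref_of M r' a"
    if "r \<in> F" "r' \<in> F" "a \<notin> {m0, m1, m2}" for r r' a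
  proof -
    have "pref_of M (R l0 l1 l2) a = (if a \<in> M then [] else q a)" for l0 l1 l2
      using that(3) by (simp add: R_def pref_of_def)
    then show ?thesis
      using that(1,2) by (force simp: F_def)
  qed
  \<comment> \<open>The letters say whether \<open>m0\<close>, \<open>m1\<close>, \<open>m2\<close>
    in turn have their first or their second option.\<close>
  let ?abb = "R [w1, w0] [w0, w2] [w1, w0]" and ?bba = "R [w2, w1] [w0, w2] [w0, w2]"
  have inF: "?abb \<in> F" "?bba \<in> F"
    by (auto simp: F_def)
  have nodiv0: "\<not> diverge es [w1, w0] [w2, w1]"
    if "node T path (Query m0 es)" "\<forall>r\<in>F. passes M r path" for path es
    using that inF prof mM mne wW wne osp
    by (intro no_divergence[OF T disj, of m0 m1 m2 w0 w1 w2 path es ?abb ?bba]) (auto simp: pm pw)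
  have nodiv1: "\<not> diverge es [w2, w1] [w0, w2]"
    if "node T path (Query m1 es)" "\<forall>r\<in>F. passes M r path" for path es
  proof -
    \<comment> \<open>In this notation the profiles are bab and abb. The three rotations use only
      abb, bab and bba: each denies the man with his first option his favourite, and gives the next
      man the favourite of that man's own first option.\<close>
    have "R [w2, w1] [w2, w1] [w1, w0] \<in> F" "R [w1, w0] [w0, w2] [w1, w0] \<in> F"
      by (auto simp: F_def)
    then show ?thesis
      using that prof mM mne wW wne osp
      by (intro no_divergence[OF T disj, of m1 m2 m0 w1 w2 w0 path es
            "R [w2, w1] [w2, w1] [w1, w0]" "R [w1, w0] [w0, w2] [w1, w0]"]) (auto simp: pm pw)
  qed
  have nodiv2: "\<not> diverge es [w0, w2] [w1, w0]"
    if "node T path (Query m2 es)" "\<forall>r\<in>F. passes M r path" for path es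
  proof -
    have "R [w2, w1] [w0, w2] [w0, w2] \<in> F" "R [w2, w1] [w2, w1] [w1, w0] \<in> F"
      by (auto simp: F_def)
    then show ?thesis
      using that prof mM mne wW wne osp
      by (intro no_divergence[OF T disj, of m2 m0 m1 w2 w0 w1 path es
            "R [w2, w1] [w0, w2] [w0, w2]" "R [w2, w1] [w2, w1] [w1, w0]"]) (auto simp: pm pw)
  qed
  have lists: "pref_of M r m0 \<in> {[w1, w0], [w2, w1]} \<and> pref_of M r m1 \<in> {[w2, w1], [w0, w2]}
      \<and> pref_of M r m2 \<in> {[w0, w2], [w1, w0]}" if "r \<in> F" for r
    using that by (auto simp: F_def pm)
  have nodiv: "\<not> diverge es (pref_of M r a) (pref_of M r' a)"
    if "node T path (Query a es)" "\<forall>r\<in>F. passes M r path" "r \<in> F" "r' \<in> F"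
      "pref_of M r a \<noteq> pref_of M r' a" for path a es r r'
  proof -
    have "a = m0 \<or> a = m1 \<or> a = m2"
      using const that by blast
    then show ?thesis
    proof (elim disjE)
      assume a: "a = m0"
      then have "\<not> diverge es [w1, w0] [w2, w1]"
        using that nodiv0 by blast
      \<comment> \<open>The two members of \<open>F\<close> may carry the man's two lists in either
        order.\<close>
      moreover from this have "\<not> diverge es [w2, w1] [w1, w0]"
        by (simp add: diverge_sym)
      ultimately show ?thesis
        using a that(5) lists[OF that(3)] lists[OF that(4)] by auto
    next
      assume a: "a = m1"
      then have "\<not> diverge es [w2, w1] [w0, w2]"
        using that nodiv1 by blast
      moreover from this have "\<not> diverge es [w0, w2] [w2, w1]"
        by (simp add: diverge_sym)
      ultimately show ?thesis
        using a that(5) lists[OF that(3)] lists[OF that(4)] by auto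
    next
      assume a: "a = m2"
      then have "\<not> diverge es [w0, w2] [w1, w0]"
        using that nodiv2 by blast
      moreover from this have "\<not> diverge es [w1, w0] [w0, w2]"
        by (simp add: diverge_sym)
      ultimately show ?thesis
        using a that(5) lists[OF that(3)] lists[OF that(4)] by auto
    qed
  qed
  \<comment> \<open>Induction on the subtree: all of \<open>F\<close> moves on together along one
    edge, until it would share a leaf. The matching there would be stable for both
    \<open>?abb\<close> and \<open>?bba\<close>, although the first rules out the pair of
    \<open>m0\<close> and \<open>w1\<close> and the second forces it.\<close>
  have unreachable: False if "node T path t" "\<forall>r\<in>F. passes M r path" for path t
    using that
  proof (induction t arbitrary: path rule: game_tree.induct)
    case (Leaf \<mu>)
    have mu: "\<mu> \<in> matchings M W"
      using mechanism_leaf[OF mech Leaf.prems(1)] .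
    have "stable M W r \<mu>" if "r \<in> F" for r
      using that st prof Leaf.prems implemented_rule_leaf[OF mech, of path \<mu> r]
      unfolding stable_rule_def by metis
    then have "stable M W ?abb \<mu>" "stable M W ?bba \<mu>"
      using inF by auto
    then show ?case
      using not_first_choice[OF _ mu disj, of ?abb m0 m2 w1 w0 m1]
        first_choice[OF _ mu disj, of ?bba m0 m1 m2 w0 w1 w2]
        mM mne wW wne pm pw by metis
  next
    case (Query a es)
    have pass: "passes M r path" if "r \<in> F" for r
      using that Query.prems by blast
    obtain S t where St: "(S, t) \<in> set es" "pref_of M ?abb a \<in> S"
      using query_edge[OF mech Query.prems(1)] pass inF prof by metis
    \<comment> \<open>The edge taken by \<open>?abb\<close> serves all of \<open>F\<close>: a member
      taking another edge would diverge from \<open>?abb\<close> here.\<close>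
    have "pref_of M r a \<in> S" if r: "r \<in> F" for r
    proof (rule ccontr)
      assume nin: "pref_of M r a \<notin> S"
      obtain S' t' where S't': "(S', t') \<in> set es" "pref_of M r a \<in> S'"
        using query_edge[OF mech Query.prems(1)] pass r prof by metis
      obtain i j where "i < length es" "es ! i = (S, t)" "j < length es" "es ! j = (S', t')"
        using St(1) S't'(1) by (auto simp: in_set_conv_nth)
      then have "diverge es (pref_of M ?abb a) (pref_of M r a)"
        unfolding diverge_def using St S't' nin by (metis fst_conv)
      then show False
        using nodiv[OF Query.prems inF(1) r] nin St(2) by metis
    qed
    then show False
      using node.edge[OF Query.prems(1) St(1)] pass
      by (intro Query.IH[OF St(1), of t "path @ [(a, S)]"]) (auto simp: passes_snoc)
  qed
  from unreachable[OF node.root] show False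
    by (simp add: passes_def)
qed

section \<open>From cardinalities to three men and three women\<close>

lemma obtain_three:
  assumes "card A \<ge> 3"
  obtains x y z where "x \<in> A" "y \<in> A" "z \<in> A" "x \<noteq> y" "y \<noteq> z" "x \<noteq> z"
proof -
  obtain B where "B \<subseteq> A" "card B = 3"
    using assms by (metis obtain_subset_with_card_n)
  then show thesis
    using that by (auto simp: card_3_iff)
qed

theorem corollary2:
  fixes M W :: "'a set"
  assumes "finite M" and "finite W" and "M \<inter> W = {}"
    and "card M \<ge> 3" and "card W \<ge> 3"
  shows "(\<forall>C. matching_rule M W C \<and> stable_rule M W C \<longrightarrow> \<not> osp_implementable M W C M) \<and>
         (\<forall>T. stable_mechanism M W T \<longrightarrow> \<not> card {m \<in> M. osp_for M W T m} > 2)"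
proof -
  have main: "\<not> card {m \<in> M. osp_for M W T m} > 2" if T: "stable_mechanism M W T" for T
  proof
    assume "card {m \<in> M. osp_for M W T m} > 2"
    then have "card {m \<in> M. osp_for M W T m} \<ge> 3"
      by simp
    then obtain m0 m1 m2 where "m0 \<in> {m \<in> M. osp_for M W T m}" "m1 \<in> {m \<in> M. osp_for M W T m}"
        "m2 \<in> {m \<in> M. osp_for M W T m}" "m0 \<noteq> m1" "m1 \<noteq> m2" "m0 \<noteq> m2"
      by (rule obtain_three)
    moreover obtain w0 w1 w2 where "w0 \<in> W" "w1 \<in> W" "w2 \<in> W" "w0 \<noteq> w1" "w1 \<noteq> w2" "w0 \<noteq> w2"
      using assms(5) by (rule obtain_three)
    ultimately show False
      using three_osp_men_impossible[OF T assms(3), of m0 m1 m2 w0 w1 w2] by simp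
  qed
  \<comment> \<open>This follows from \<open>main\<close>: an implementing mechanism inherits
    stability from \<open>C\<close>, and all of the at least three men would be obviously
    strategy-proof in it.\<close>
  moreover have "\<not> osp_implementable M W C M" if "stable_rule M W C" for C
  proof
    assume "osp_implementable M W C M"
    then obtain T where T: "mechanism M W T" "\<forall>r\<in>profiles M W. C r = implemented_rule M T r"
        "\<forall>a\<in>M. osp_for M W T a"
      by (auto simp: osp_implementable_def)
    then have "stable_mechanism M W T"
      using that by (auto simp: stable_mechanism_def stable_rule_def)
    moreover have "{m \<in> M. osp_for M W T m} = M"
      using T(3) by auto
    ultimately show False
      using main assms(4) by fastforce
  qed
  ultimately show ?thesis
    by blast
qed

end
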